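(* Let $f:\mathbb{Z}^n\to\mathbb{R}\cup\{+\infty\}$ be a DDM-convex function with $\operatorname{argmin} f\ne\emptyset$, let $x^{(0)}\in\operatorname{dom} f\setminus\operatorname{argmin} f$ be the initial point, and let $L=\min\{\|x-x^{(0)}\|_\infty\mid x\in\operatorname{argmin} f\}$. Then the 1-neighborhood steepest descent algorithm started at $x^{(0)}$ finds a minimizer of $f$ exactly in $L+1$ iterations, that is, it stops after exactly $L+1$ calls of the 1-neighborhood minimization oracle and its output is a minimizer of $f$.
   Context: $\operatorname{dom} f=\{x\in\mathbb{Z}^n\mid f(x)<+\infty\}$ and $\operatorname{argmin} f=\{x\in\mathbb{Z}^n\mid f(x)\le f(z)\ \forall z\in\mathbb{Z}^n\}$. For $x,y\in\mathbb{Z}^n$, the vector $\mu(x,y)\in\mathbb{Z}^n$ is defined componentwise by $\mu(x,y)_i=\lceil (x_i+y_i)/2\rceil$ if $x_i\ge y_i$, and $\mu(x,y)_i=\lfloor (x_i+y_i)/2\rfloor$ if $x_i<y_i$. A function $f:\mathbb{Z}^n\to\mathbb{R}\cup\{+\infty\}$ is called DDM-convex if $f(x)+f(y)\ge f(\mu(x,y))+f(\mu(y,x))$ for all $x,y\in\mathbb{Z}^n$. The 1-neighborhood of $x\in\mathbb{Z}^n$ is $N_1(x)=\{z\in\mathbb{Z}^n\mid\|z-x\|_\infty\le1\}$. A 1-neighborhood minimization oracle returns, for any given $x\in\operatorname{dom} f$, some (arbitrary) point minimizing $f$ over $N_1(x)$. The 1-neighborhood steepest descent algorithm: D0: Take the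 initial point $x^{(0)}\in\operatorname{dom} f$ and set $k:=1$. D1: Find $x^{(k)}$ that minimizes $f$ in $N_1(x^{(k-1)})$ (one oracle call). D2: If $f(x^{(k)})=f(x^{(k-1)})$, then output $x^{(k-1)}$ and stop. D3: Set $k:=k+1$ and go to D1. One iteration is one execution of D1. *)

theory Defs
  imports "HOL-Analysis.Finite_Cartesian_Product" "HOL-Library.Extended_Real"
begin

text \<open>Functions from the integer lattice to the reals extended by plus infinity are maps
  \<open>int ^ 'n \<Rightarrow> ereal\<close> that never take the value \<open>-\<infinity>\<close>; the latter is stated as a separate
  hypothesis where it is needed.\<close>

definition eff_dom :: "(int ^ 'n \<Rightarrow> ereal) \<Rightarrow> (int ^ 'n) set" where
  "eff_dom f = {x. f x < \<infinity>}"

definition argmin_set :: "(int ^ 'n \<Rightarrow> ereal) \<Rightarrow> (int ^ 'n) set" where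
  "argmin_set f = {x. \<forall>z. f x \<le> f z}"

definition mu :: "int ^ 'n \<Rightarrow> int ^ 'n \<Rightarrow> int ^ 'n" where
  "mu x y = (\<chi> i. if x $ i \<ge> y $ i
                 then \<lceil>(real_of_int (x $ i) + real_of_int (y $ i)) / 2\<rceil>
                 else \<lfloor>(real_of_int (x $ i) + real_of_int (y $ i)) / 2\<rfloor>)"

definition DDM_convex :: "(int ^ 'n \<Rightarrow> ereal) \<Rightarrow> bool" where
  "DDM_convex f \<longleftrightarrow> (\<forall>x y. f x + f y \<ge> f (mu x y) + f (mu y x))"

text \<open>The maximum norm of an integer vector is a natural number.\<close>

definition linf_norm :: "int ^ 'n \<Rightarrow> nat" where
  "linf_norm x = (MAX i. nat \<bar>x $ i\<bar>)"

definition nbhd1 :: "int ^ 'n \<Rightarrow> (int ^ 'n) set" where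
  "nbhd1 x = {z. linf_norm (z - x) \<le> 1}"

text \<open>The oracle is a relation, so that nothing is assumed about how ties are broken: repeated
  queries at the same point may even receive different answers. It accepts only queries in the
  effective domain.\<close>

definition oracle_answer :: "(int ^ 'n \<Rightarrow> ereal) \<Rightarrow> int ^ 'n \<Rightarrow> int ^ 'n \<Rightarrow> bool" where
  "oracle_answer f x z \<longleftrightarrow> x \<in> eff_dom f \<and> z \<in> nbhd1 x \<and> (\<forall>w \<in> nbhd1 x. f z \<le> f w)"

text \<open>Configurations of the 1-neighborhood steepest descent algorithm. The number is the count of
  oracle calls made so far. \<open>Running x m\<close> has current iterate \<open>x\<close>, and \<open>Halted y m\<close> has
  output \<open>y\<close>. One step is one execution of D1 followed by the test D2. Note that on
  stopping the output is the point queried and not the answer of the oracle.\<close>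

datatype 'a config = Running 'a nat | Halted 'a nat

inductive sd_step :: "(int ^ 'n \<Rightarrow> ereal) \<Rightarrow> (int ^ 'n) config \<Rightarrow> (int ^ 'n) config \<Rightarrow> bool"
  for f where
  stop: "oracle_answer f x z \<Longrightarrow> f z = f x \<Longrightarrow> sd_step f (Running x m) (Halted x (Suc m))"
| continue: "oracle_answer f x z \<Longrightarrow> f z \<noteq> f x \<Longrightarrow> sd_step f (Running x m) (Running z (Suc m))"

text \<open>Total correctness of all executions: none is infinite, and each one that cannot be
  continued has halted (it is not stuck in a running configuration) after exactly \<open>N\<close> oracle
  calls, with an output in \<open>S\<close>.\<close>

definition always_halts_in ::
  "(int ^ 'n \<Rightarrow> ereal) \<Rightarrow> int ^ 'n \<Rightarrow> nat \<Rightarrow> (int ^ 'n) set \<Rightarrow> bool" where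
  "always_halts_in f x0 N S \<longleftrightarrow>
     (\<nexists>c. c 0 = Running x0 0 \<and> (\<forall>k. sd_step f (c k) (c (Suc k)))) \<and>
     (\<forall>c. (sd_step f)\<^sup>*\<^sup>* (Running x0 0) c \<and> (\<nexists>c'. sd_step f c c') \<longrightarrow>
          (\<exists>y \<in> S. c = Halted y N))"

end

theory Submission
  imports Defs
begin

text \<open>
  The reason for the exact count is that steepest descent does not merely approach a minimizer: its
  \<open>k\<close>-th iterate minimizes \<open>f\<close> over the whole box \<open>B k\<close> of points at maximum-norm distance at most
  \<open>k\<close> from the initial point (lemma \<open>minimum_propagates\<close>).

  Suppose that \<open>x\<close> minimizes \<open>f\<close> over \<open>B k\<close>, and let \<open>z\<close> be any point of \<open>B (k + 1)\<close> at distance at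
  least 2 from \<open>x\<close>. In each coordinate, \<open>mu x z\<close> is the midpoint of \<open>x\<close> and \<open>z\<close> rounded towards \<open>x\<close>.
  It is therefore either the coordinate of \<open>x\<close> itself or one that keeps distance at least 1 from the
  coordinate of \<open>z\<close> on the side of \<open>x\<close>; this puts \<open>mu x z\<close> into the smaller box \<open>B k\<close>, whence
  \<open>f x \<le> f (mu x z)\<close>. Cancelling in the inequality of DDM-convexity leaves \<open>f (mu z x) \<le> f z\<close>, where
  \<open>mu z x\<close> lies in \<open>B (k + 1)\<close> and is strictly closer to \<open>x\<close> than \<open>z\<close> was. Iterating, one reaches a
  point of the 1-neighborhood of \<open>x\<close> whose value is at most \<open>f z\<close>. So a minimizer of \<open>f\<close> over that
  neighborhood is as good as every point of \<open>B (k + 1)\<close>.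

  The count follows. If the algorithm stops at the query \<open>x\<close>, then \<open>x\<close> minimizes \<open>f\<close> over its own
  1-neighborhood, and propagating this minimality from \<open>x\<close> outwards through all boxes around \<open>x\<close>
  shows that \<open>x\<close> is a global minimizer. Hence the algorithm cannot stop before its iterate is at
  distance \<open>L\<close> from the initial point, which takes \<open>L\<close> moves. On the other hand \<open>B L\<close> contains a
  global minimizer, so the iterate after \<open>L\<close> moves is one too, and the next call only confirms this.
\<close>

section \<open>Boxes and directed midpoints\<close>

definition linf_ball :: "int ^ 'n \<Rightarrow> nat \<Rightarrow> (int ^ 'n) set" where
  "linf_ball c k = {z. linf_norm (z - c) \<le> k}"

lemma linf_norm_le_iff: "linf_norm x \<le> k \<longleftrightarrow> (\<forall>i. \<bar>x $ i\<bar> \<le> int k)"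
  unfolding linf_norm_def by (subst Max_le_iff) (auto simp: nat_le_iff)

lemma mem_linf_ball_iff: "z \<in> linf_ball c k \<longleftrightarrow> (\<forall>i. \<bar>z $ i - c $ i\<bar> \<le> int k)"
  by (simp add: linf_ball_def linf_norm_le_iff)

lemma linf_ball_0: "linf_ball c 0 = {c}"
  by (auto simp: mem_linf_ball_iff vec_eq_iff)

lemma nbhd1_eq_linf_ball: "nbhd1 x = linf_ball x 1"
  by (simp add: nbhd1_def linf_ball_def)

lemma center_in_nbhd1: "x \<in> nbhd1 x"
  by (simp add: nbhd1_eq_linf_ball mem_linf_ball_iff)

lemma nbhd1_subset_linf_ball_Suc:
  assumes "x \<in> linf_ball c k"
  shows "nbhd1 x \<subseteq> linf_ball c (Suc k)"
proof
  fix z assume z: "z \<in> nbhd1 x"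
  have "\<bar>z $ i - c $ i\<bar> \<le> int (Suc k)" for i
  proof -
    have "\<bar>z $ i - x $ i\<bar> \<le> 1" "\<bar>x $ i - c $ i\<bar> \<le> int k"
      using z assms by (auto simp: nbhd1_eq_linf_ball mem_linf_ball_iff)
    then show ?thesis by linarith
  qed
  then show "z \<in> linf_ball c (Suc k)" by (simp add: mem_linf_ball_iff)
qed

lemma finite_nbhd1: "finite (nbhd1 (x :: int ^ 'n))"
proof (rule finite_subset)
  show "nbhd1 x \<subseteq> vec_lambda ` (\<Pi>\<^sub>E i\<in>UNIV. {x $ i - 1 .. x $ i + 1})"
  proof
    fix z assume z: "z \<in> nbhd1 x"
    have "z $ i \<in> {x $ i - 1 .. x $ i + 1}" for i
    proof -
      have "\<bar>z $ i - x $ i\<bar> \<le> 1"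
        using z by (simp add: nbhd1_eq_linf_ball mem_linf_ball_iff)
      then show ?thesis by simp linarith
    qed
    then have "vec_nth z \<in> (\<Pi>\<^sub>E i\<in>UNIV. {x $ i - 1 .. x $ i + 1})"
      by (auto simp: PiE_UNIV_domain)
    then show "z \<in> vec_lambda ` (\<Pi>\<^sub>E i\<in>UNIV. {x $ i - 1 .. x $ i + 1})"
      by (intro image_eqI[where x = "vec_nth z"]) simp_all
  qed
  show "finite (vec_lambda ` (\<Pi>\<^sub>E i\<in>UNIV. {x $ i - 1 .. x $ i + 1}) :: (int ^ 'n) set)"
    by (intro finite_imageI finite_PiE) auto
qed

lemma mu_nth:
  "mu x y $ i = (if x $ i \<ge> y $ i then (x $ i + y $ i + 1) div 2 else (x $ i + y $ i) div 2)"
proof -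
  have half: "(real_of_int a + real_of_int b) / 2 = real_of_int (a + b) / real_of_int 2" for a b
    by simp
  have up: "\<lceil>real_of_int a / real_of_int 2\<rceil> = (a + 1) div 2" for a
    unfolding ceiling_divide_eq_div by linarith
  have down: "\<lfloor>real_of_int a / real_of_int 2\<rfloor> = a div 2" for a
    by (rule floor_divide_of_int_eq)
  show ?thesis
    unfolding mu_def by (simp only: vec_lambda_beta half up down)
qed

text \<open>Rounding towards \<open>x\<close> never produces the coordinate of \<open>z\<close> unless \<open>x\<close> has it too. So a
  coordinate in which \<open>z\<close> touches the outermost layer of the larger box is moved off that layer.\<close>

lemma mu_in_smaller_ball:
  assumes "x \<in> linf_ball c k" "z \<in> linf_ball c (Suc k)"
  shows "mu x z \<in> linf_ball c k"
  unfolding mem_linf_ball_iff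
proof
  fix i
  have "\<bar>x $ i - c $ i\<bar> \<le> int k" "\<bar>z $ i - c $ i\<bar> \<le> int k + 1"
    using assms by (auto simp: mem_linf_ball_iff algebra_simps)
  then show "\<bar>mu x z $ i - c $ i\<bar> \<le> int k"
    by (auto simp: mu_nth)
qed

lemma mu_in_ball:
  assumes "x \<in> linf_ball c k" "z \<in> linf_ball c k"
  shows "mu z x \<in> linf_ball c k"
  unfolding mem_linf_ball_iff
proof
  fix i
  have "\<bar>x $ i - c $ i\<bar> \<le> int k" "\<bar>z $ i - c $ i\<bar> \<le> int k"
    using assms by (auto simp: mem_linf_ball_iff)
  then show "\<bar>mu z x $ i - c $ i\<bar> \<le> int k"
    by (auto simp: mu_nth)
qed

text \<open>Rounding away from the target \<open>x\<close> turns a distance \<open>d\<close> into \<open>\<lceil>d/2\<rceil>\<close>, which is a decrease as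
  soon as \<open>d \<ge> 2\<close>; a difference of 1 is not reduced, so distance 1 is where the iteration ends.\<close>

lemma mu_strictly_closer:
  assumes "z \<in> linf_ball x (Suc (Suc d))"
  shows "mu z x \<in> linf_ball x (Suc d)"
  unfolding mem_linf_ball_iff
proof
  fix i
  have "\<bar>z $ i - x $ i\<bar> \<le> int d + 2"
    using assms by (auto simp: mem_linf_ball_iff algebra_simps)
  then have "\<bar>mu z x $ i - x $ i\<bar> \<le> int d + 1"
    by (auto simp: mu_nth)
  then show "\<bar>mu z x $ i - x $ i\<bar> \<le> int (Suc d)" by simp
qed

section \<open>Minimality over growing boxes\<close>

definition minimizes_on :: "('a \<Rightarrow> ereal) \<Rightarrow> 'a set \<Rightarrow> 'a \<Rightarrow> bool" where
  "minimizes_on f S x \<longleftrightarrow> x \<in> S \<and> (\<forall>z \<in> S. f x \<le> f z)"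

lemma oracle_answer_iff:
  "oracle_answer f x z \<longleftrightarrow> x \<in> eff_dom f \<and> minimizes_on f (nbhd1 x) z"
  by (simp add: oracle_answer_def minimizes_on_def)

text \<open>The cancellation is legitimate because \<open>f x\<close> is finite: if \<open>f z\<close> is infinite there is nothing to show, and otherwise the
  inequality of DDM-convexity makes all four values finite.\<close>

lemma DDM_convex_cancel:
  assumes "\<And>y. f y \<noteq> -\<infinity>" "DDM_convex f" "f x < \<infinity>" "f x \<le> f (mu x z)"
  shows "f (mu z x) \<le> f z"
proof -
  have "f (mu x z) + f (mu z x) \<le> f x + f z"
    using assms(2) by (simp add: DDM_convex_def)
  then show ?thesis
    using assms(1)[of x] assms(1)[of z] assms(1)[of "mu x z"] assms(1)[of "mu z x"] assms(3,4)
    by (cases "f x"; cases "f z"; cases "f (mu x z)"; cases "f (mu z x)") auto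
qed

text \<open>The heart of the matter: halving the distance to \<open>x\<close> repeatedly never increases \<open>f\<close>, because
  the partner midpoints all stay in the box on which \<open>x\<close> is optimal.\<close>

lemma better_point_in_nbhd1:
  assumes "\<And>y. f y \<noteq> -\<infinity>" "DDM_convex f" "f x < \<infinity>"
    and min: "minimizes_on f (linf_ball c k) x"
    and "z \<in> linf_ball c (Suc k)"
  shows "\<exists>w \<in> nbhd1 x. f w \<le> f z"
proof -
  have x: "x \<in> linf_ball c k" "x \<in> linf_ball c (Suc k)"
    using min by (auto simp: minimizes_on_def linf_ball_def)
  have "\<exists>w \<in> nbhd1 x. f w \<le> f z"
    if "z \<in> linf_ball x (Suc d)" "z \<in> linf_ball c (Suc k)" for d z
    using that
  proof (induction d arbitrary: z)
    case 0
    then show ?case by (auto simp: nbhd1_eq_linf_ball)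
  next
    case (Suc d)
    have "f x \<le> f (mu x z)"
      using min mu_in_smaller_ball[OF x(1) Suc.prems(2)] by (simp add: minimizes_on_def)
    then have "f (mu z x) \<le> f z"
      by (rule DDM_convex_cancel[OF assms(1-3)])
    moreover obtain w where "w \<in> nbhd1 x" "f w \<le> f (mu z x)"
      using Suc.IH[OF mu_strictly_closer[OF Suc.prems(1)] mu_in_ball[OF x(2) Suc.prems(2)]]
      by blast
    ultimately show ?case by (meson order_trans)
  qed
  moreover have "z \<in> linf_ball x (Suc (linf_norm (z - x)))"
    by (simp add: linf_ball_def)
  ultimately show ?thesis using assms(5) by blast
qed

lemma minimum_propagates:
  assumes "\<And>y. f y \<noteq> -\<infinity>" "DDM_convex f" "f x < \<infinity>"
    and min: "minimizes_on f (linf_ball c k) x"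
    and z: "minimizes_on f (nbhd1 x) z"
  shows "minimizes_on f (linf_ball c (Suc k)) z"
  unfolding minimizes_on_def
proof (intro conjI ballI)
  show "z \<in> linf_ball c (Suc k)"
    using nbhd1_subset_linf_ball_Suc min z by (auto simp: minimizes_on_def)
next
  fix y assume "y \<in> linf_ball c (Suc k)"
  then obtain w where "w \<in> nbhd1 x" "f w \<le> f y"
    using better_point_in_nbhd1[OF assms(1-3) min] by blast
  then show "f z \<le> f y"
    using z by (meson minimizes_on_def order_trans)
qed

text \<open>Local minimality is the special case of propagation in which the boxes are centred at \<open>x\<close> and
  \<open>x\<close> is its own best neighbor.\<close>

lemma local_minimum_imp_global:
  assumes "\<And>y. f y \<noteq> -\<infinity>" "DDM_convex f" "f x < \<infinity>" "minimizes_on f (nbhd1 x) x"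
  shows "x \<in> argmin_set f"
proof -
  have "minimizes_on f (linf_ball x k) x" for k
  proof (induction k)
    case 0
    show ?case by (simp add: linf_ball_0 minimizes_on_def)
  next
    case (Suc k)
    then show ?case by (rule minimum_propagates[OF assms(1-3) _ assms(4)])
  qed
  moreover have "z \<in> linf_ball x (linf_norm (z - x))" for z
    by (simp add: linf_ball_def)
  ultimately show ?thesis by (auto simp: argmin_set_def minimizes_on_def)
qed

section \<open>Executions of the algorithm\<close>

text \<open>The state after \<open>m\<close> oracle calls without stopping. The bound \<open>m \<le> L\<close> belongs to the invariant
  because it is what rules out an execution that goes on for too long; the finiteness of \<open>f x\<close> keeps
  the next query legal.\<close>

definition descent_invariant ::
  "(int ^ 'n \<Rightarrow> ereal) \<Rightarrow> int ^ 'n \<Rightarrow> nat \<Rightarrow> int ^ 'n \<Rightarrow> nat \<Rightarrow> bool" where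
  "descent_invariant f x0 L x m \<longleftrightarrow> f x < \<infinity> \<and> m \<le> L \<and> minimizes_on f (linf_ball x0 m) x"

lemma oracle_answer_exists:
  assumes "f x < \<infinity>"
  shows "\<exists>z. oracle_answer f x z"
proof -
  have "nbhd1 x \<noteq> {}" using center_in_nbhd1 by blast
  then obtain z where "is_arg_min f (\<lambda>z. z \<in> nbhd1 x) z"
    using ex_is_arg_min_if_finite[OF finite_nbhd1] by blast
  then show ?thesis
    using assms by (auto simp: oracle_answer_def eff_dom_def is_arg_min_linorder)
qed

lemma sd_step_possible:
  assumes "f x < \<infinity>"
  shows "\<exists>c'. sd_step f (Running x m) c'"
proof -
  obtain z where "oracle_answer f x z"
    using oracle_answer_exists[of f x] assms by blast
  then show ?thesis
    by (cases "f z = f x") (blast intro: sd_step.intros)+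
qed

lemma minimizer_in_last_ball:
  assumes "p \<in> argmin_set f" "p \<in> linf_ball x0 L" "minimizes_on f (linf_ball x0 L) x"
  shows "x \<in> argmin_set f"
proof -
  have "f x \<le> f p" using assms(2,3) by (simp add: minimizes_on_def)
  moreover have "f p \<le> f y" for y using assms(1) by (simp add: argmin_set_def)
  ultimately have "f x \<le> f y" for y by (rule order_trans)
  then show ?thesis by (simp add: argmin_set_def)
qed

text \<open>Here \<open>p\<close> witnesses that a minimizer is found within distance \<open>L\<close>, so that the algorithm must
  stop as soon as the iterate is optimal on the box of radius \<open>L\<close>.\<close>

lemma descent_invariant_continue:
  assumes "\<And>y. f y \<noteq> -\<infinity>" "DDM_convex f"
    and p: "p \<in> argmin_set f" "p \<in> linf_ball x0 L"
    and inv: "descent_invariant f x0 L x m"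
    and z: "oracle_answer f x z" "f z \<noteq> f x"
  shows "descent_invariant f x0 L z (Suc m)"
proof -
  have x: "f x < \<infinity>" "m \<le> L" "minimizes_on f (linf_ball x0 m) x"
    using inv by (auto simp: descent_invariant_def)
  have z': "minimizes_on f (nbhd1 x) z"
    using z(1) by (simp add: oracle_answer_iff)
  have le: "f z \<le> f x"
    using z' center_in_nbhd1 by (auto simp: minimizes_on_def)
  have "m \<noteq> L"
  proof
    assume "m = L"
    then have "x \<in> argmin_set f" using minimizer_in_last_ball[OF p] x(3) by blast
    then show False using le z(2) by (simp add: argmin_set_def order_antisym)
  qed
  then show ?thesis
    using x(2) le_less_trans[OF le x(1)] minimum_propagates[OF assms(1,2) x(1,3) z']
    by (simp add: descent_invariant_def)
qed

text \<open>The output is a global minimizer at distance at most \<open>m\<close> from the initial point. As no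
  minimizer is closer than \<open>L\<close>, it follows that \<open>m = L\<close>.\<close>

lemma descent_invariant_stop:
  assumes "\<And>y. f y \<noteq> -\<infinity>" "DDM_convex f"
    and far: "\<And>q. q \<in> argmin_set f \<Longrightarrow> L \<le> linf_norm (q - x0)"
    and inv: "descent_invariant f x0 L x m"
    and z: "oracle_answer f x z" "f z = f x"
  shows "x \<in> argmin_set f \<and> m = L"
proof -
  have "minimizes_on f (nbhd1 x) x"
    using z center_in_nbhd1 by (auto simp: oracle_answer_iff minimizes_on_def)
  moreover have "f x < \<infinity>"
    using inv by (simp add: descent_invariant_def)
  ultimately have opt: "x \<in> argmin_set f"
    using local_minimum_imp_global[OF assms(1,2)] by blast
  have "linf_norm (x - x0) \<le> m" "m \<le> L"
    using inv by (auto simp: descent_invariant_def minimizes_on_def linf_ball_def)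
  then show ?thesis using opt far[OF opt] by simp
qed

theorem theorem8p2:
  fixes f :: "int ^ 'n \<Rightarrow> ereal" and x0 :: "int ^ 'n" and L :: nat
  assumes "\<And>x. f x \<noteq> -\<infinity>"
    and "DDM_convex f"
    and "argmin_set f \<noteq> {}"
    and "x0 \<in> eff_dom f - argmin_set f"
    and "L = (LEAST d. d \<in> {linf_norm (x - x0) | x. x \<in> argmin_set f})"
  shows "always_halts_in f x0 (L + 1) (argmin_set f)"
proof -
  let ?D = "{linf_norm (x - x0) | x. x \<in> argmin_set f}"
  have "\<exists>d. d \<in> ?D" using assms(3) by blast
  then have "L \<in> ?D"
    unfolding assms(5) by (rule LeastI_ex)
  then obtain p where p: "p \<in> argmin_set f" "p \<in> linf_ball x0 L"
    by (auto simp: linf_ball_def)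
  have far: "L \<le> linf_norm (q - x0)" if "q \<in> argmin_set f" for q
    unfolding assms(5) using that by (intro Least_le) blast
  define good where "good c \<longleftrightarrow>
    (case c of Running x m \<Rightarrow> descent_invariant f x0 L x m
             | Halted y m \<Rightarrow> y \<in> argmin_set f \<and> m = L + 1)" for c
  have good_init: "good (Running x0 0)"
    using assms(4)
    by (simp add: good_def descent_invariant_def eff_dom_def minimizes_on_def linf_ball_0)
  have good_step: "good c'" if "sd_step f c c'" "good c" for c c'
    using that
  proof cases
    case (stop x z m)
    then show ?thesis
      using descent_invariant_stop[OF assms(1,2) far, of x m z] that(2) by (simp add: good_def)
  next
    case (continue x z m)
    then show ?thesis
      using descent_invariant_continue[OF assms(1,2) p, of x m z] that(2)
      by (simp add: good_def)
  qed
  show ?thesis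
    unfolding always_halts_in_def
  proof (intro conjI allI impI notI)
    assume "\<exists>c. c 0 = Running x0 0 \<and> (\<forall>k. sd_step f (c k) (c (Suc k)))"
    then obtain c where c0: "c 0 = Running x0 0" and step: "\<And>k. sd_step f (c k) (c (Suc k))"
      by blast
    have "good (c k) \<and> (\<exists>x. c k = Running x k)" for k
    proof (induction k)
      case 0
      then show ?case using c0 good_init by simp
    next
      case (Suc k)
      \<comment> \<open>A halted configuration has no successor, so the next one is still running.\<close>
      then have "\<exists>x. c (Suc k) = Running x (Suc k)"
        using step[of k] step[of "Suc k"] by (auto elim!: sd_step.cases)
      then show ?case using good_step step Suc by blast
    qed
    \<comment> \<open>Still running after \<open>L + 1\<close> calls would contradict the bound in the invariant.\<close>
    from this[of "Suc L"] show False
      by (auto simp: good_def descent_invariant_def)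
  next
    fix c
    assume "(sd_step f)\<^sup>*\<^sup>* (Running x0 0) c \<and> (\<nexists>c'. sd_step f c c')"
    then have reach: "(sd_step f)\<^sup>*\<^sup>* (Running x0 0) c" and stuck: "\<nexists>c'. sd_step f c c'"
      by auto
    from reach have "good c"
      by (induction rule: rtranclp_induct) (use good_init good_step in blast)+
    then show "\<exists>y \<in> argmin_set f. c = Halted y (L + 1)"
    proof (cases c)
      case (Running x m)
      then have "f x < \<infinity>"
        using \<open>good c\<close> by (simp add: good_def descent_invariant_def)
      then show ?thesis
        using sd_step_possible stuck Running by blast
    next
      case (Halted y m)
      then show ?thesis using \<open>good c\<close> by (simp add: good_def)
    qed
  qed
qed

end
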